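(* Let $\tau$ be a task with finite event list $E_\tau$ of event tuples $e$ with period $p_e\ge 0$ and minimal distance $a_e\ge 0$, let $k\in\mathbb N\cup\{\infty\}$ (with all $p_e>0$ if $k=\infty$), let $\Delta_{a,b}=[t_a,t_b)$ be a bounded interval, and let $t\in\mathbb R$. Then the number $\eta_\tau(t,\Delta_{a,b})_k$ of events of $\tau$ that lie in $[t_a,t_b)$ and occur no later than $t$ is $$\eta_\tau(t,\Delta_{a,b})_k=\int_{-\infty}^{t}\Big(\sum_{e\in E_\tau}\sum_{n=0}^{k-1}\delta(t'-a_e-np_e)\Big)H^{u}(t'-t_a)\,H^{l}(t_b-t')\,dt'$$ $$=\int_{t_a}^{t}\Big(\sum_{e\in E_\tau}\sum_{n=0}^{k-1}\delta(t'-a_e-np_e)\Big)H^{l}(t_b-t')\,dt'.$$ In the special case of the periodic event model with period $p_\tau>0$ this becomes $$\eta_\tau(t,\Delta_{a,b})=\int_{-\infty}^{t}\Big(\sum_{n=0}^{\infty}\delta(t'-np_\tau)\Big)H^{u}(t'-t_a)\,H^{l}(t_b-t')\,dt'=\int_{t_a}^{t}\Big(\sum_{n=0}^{\infty}\delta(t'-np_\tau)\Big)H^{l}(t_b-t')\,dt'.$$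
   Context: The events of $\tau$ are the pairs $(e,n)$ with $e\in E_\tau$, $n\in\mathbb N_0$, $0\le n\le k-1$ (all $n\ge 0$ if $k=\infty$); the event $(e,n)$ occurs at time $a_e+np_e$, and events are counted with multiplicity. The periodic event model is the event list consisting of one tuple with $a_e=0$, $p_e=p_\tau$, and $k=\infty$. $\delta$ is the Dirac delta, i.e. $\delta(t'-s)\,dt'$ is the unit point mass at $s$, and the sum of Dirac deltas is the corresponding sum of point masses. Integrals $\int_x^t$ are over the closed interval $[x,t]$ (empty, with integral $0$, if $t<x$) and $\int_{-\infty}^t$ is over $(-\infty,t]$, so that point masses at the endpoints are included. Upper Heaviside function: $H^u(x)=1$ for $x\ge 0$ and $0$ for $x<0$. Lower Heaviside function: $H^l(x)=1$ for $x>0$ and $0$ for $x\le 0$. *)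

theory Defs
  imports "HOL-Probability.Probability" "HOL-Library.Extended_Nat"
begin

definition heaviside_upper :: "real \<Rightarrow> real" where
  "heaviside_upper x = (if x \<ge> 0 then 1 else 0)"

definition heaviside_lower :: "real \<Rightarrow> real" where
  "heaviside_lower x = (if x > 0 then 1 else 0)"

record event_tuple =
  period :: real
  distance :: real

text \<open>An event list is a list, and an event tuple is addressed by its index in the list, so that
  equal tuples at different positions contribute separate events.\<close>

definition events :: "event_tuple list \<Rightarrow> enat \<Rightarrow> (nat \<times> nat) set" where
  "events E k = {(i, n). i < length E \<and> enat n < k}"

definition occurrence :: "event_tuple list \<Rightarrow> nat \<times> nat \<Rightarrow> real" where
  "occurrence E = (\<lambda>(i, n). distance (E ! i) + real n * period (E ! i))"

definition counted_events :: "event_tuple list \<Rightarrow> enat \<Rightarrow> real \<Rightarrow> real set \<Rightarrow> (nat \<times> nat) set" where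
  "counted_events E k t D = {x \<in> events E k. occurrence E x \<in> D \<and> occurrence E x \<le> t}"

definition \<eta> :: "event_tuple list \<Rightarrow> enat \<Rightarrow> real \<Rightarrow> real set \<Rightarrow> nat" where
  "\<eta> E k t D = card (counted_events E k t D)"

definition periodic_event_model :: "real \<Rightarrow> event_tuple list" where
  "periodic_event_model p = [\<lparr>period = p, distance = 0\<rparr>]"

definition dirac :: "real \<Rightarrow> real measure" where
  "dirac s = return borel s"

definition sum_measure :: "nat set \<Rightarrow> (nat \<Rightarrow> real measure) \<Rightarrow> real measure" where
  "sum_measure I M = measure_of UNIV (sets borel) (\<lambda>A. \<Sum>\<^sub>\<infinity>i\<in>I. emeasure (M i) A)"

definition event_measure :: "event_tuple list \<Rightarrow> enat \<Rightarrow> real measure" where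
  "event_measure E k =
     sum_measure {..<length E} (\<lambda>i. sum_measure {n. enat n < k}
       (\<lambda>n. dirac (distance (E ! i) + real n * period (E ! i))))"

lemma sets_dirac [simp, measurable_cong]: "sets (dirac s) = sets borel"
  by (simp add: dirac_def)

lemma emeasure_dirac: "A \<in> sets borel \<Longrightarrow> emeasure (dirac s) A = indicator A s"
  by (simp add: dirac_def)

lemma sets_sum_measure [simp, measurable_cong]: "sets (sum_measure I M) = sets borel"
  unfolding sum_measure_def by (metis sets.sets_measure_of_eq space_borel)

lemma infsum_ennreal_eq_suminf:
  fixes f :: "nat \<Rightarrow> ennreal"
  shows "infsum f I = (\<Sum>n. if n \<in> I then f n else 0)"
proof -
  let ?g = "\<lambda>n. if n \<in> I then f n else 0"
  have "?g summable_on UNIV"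
    by (rule nonneg_summable_on_complete) simp
  then have "(?g has_sum infsum ?g UNIV) UNIV"
    by (rule has_sum_infsum)
  then have "?g sums infsum ?g UNIV"
    by (rule has_sum_imp_sums)
  moreover have "infsum f I = infsum ?g UNIV"
    by (rule infsum_cong_neutral) auto
  ultimately show ?thesis
    by (simp add: sums_iff)
qed

text \<open>The set function defining \<open>sum_measure\<close> is a measure, so that \<open>measure_of\<close> does not
  fall back to the zero measure.\<close>

lemma emeasure_sum_measure:
  assumes "\<And>i. i \<in> I \<Longrightarrow> sets (M i) = sets borel" and "A \<in> sets borel"
  shows "emeasure (sum_measure I M) A = (\<Sum>\<^sub>\<infinity>i\<in>I. emeasure (M i) A)"
proof -
  let ?\<mu> = "\<lambda>A. \<Sum>\<^sub>\<infinity>i\<in>I. emeasure (M i) A"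
  have nn: "?\<mu> A = (\<integral>\<^sup>+i. (if i \<in> I then emeasure (M i) A else 0) \<partial>count_space UNIV)" for A
    by (simp add: infsum_ennreal_eq_suminf nn_integral_count_space_nat)
  have "countably_additive (sets (sum_measure I M)) ?\<mu>"
  proof (rule countably_additiveI)
    fix B :: "nat \<Rightarrow> real set"
    assume B: "range B \<subseteq> sets (sum_measure I M)" "disjoint_family B"
    have "(\<Sum>j. ?\<mu> (B j)) =
        (\<integral>\<^sup>+i. (\<Sum>j. if i \<in> I then emeasure (M i) (B j) else 0) \<partial>count_space UNIV)"
      unfolding nn by (rule nn_integral_suminf[symmetric]) simp
    also have "\<dots> = (\<integral>\<^sup>+i. (if i \<in> I then emeasure (M i) (\<Union>j. B j) else 0) \<partial>count_space UNIV)"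
    proof (rule nn_integral_cong)
      fix i
      show "(\<Sum>j. if i \<in> I then emeasure (M i) (B j) else 0) =
          (if i \<in> I then emeasure (M i) (\<Union>j. B j) else 0)"
        using B assms(1)[of i] suminf_emeasure[of B "M i"] by auto
    qed
    finally show "(\<Sum>j. ?\<mu> (B j)) = ?\<mu> (\<Union>j. B j)"
      unfolding nn .
  qed
  moreover have "positive (sets (sum_measure I M)) ?\<mu>"
    by (simp add: positive_def)
  ultimately show ?thesis
    using assms(2) by (intro emeasure_measure_of[OF sum_measure_def]) auto
qed

end

theory Submission
  imports Defs
begin

text \<open>On the respective ranges of integration both integrands coincide with the indicator function of
  \<open>[t\<^sub>a, t\<^sub>b) \<inter> (-\<infinity>, t]\<close>, so both integrals are the mass of this set, and a sum of point masses
  gives it one unit for every event that occurs in it. This mass is finite: if an event tuple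
  generates infinitely many events, then its period is positive, so only finitely many of them
  occur by time \<open>t\<close>.\<close>

text \<open>Each index with \<open>f n\<close> in \<open>A\<close> contributes 1 and every other
  index 0. Finiteness matters: \<open>card\<close> of an infinite set is 0, whereas the sum of its
  ones is \<open>\<infinity>\<close>.\<close>

lemma infsum_indicator_ennreal:
  assumes "finite {n \<in> I. f n \<in> A}"
  shows "(\<Sum>\<^sub>\<infinity>n\<in>I. indicator A (f n)) = (of_nat (card {n \<in> I. f n \<in> A}) :: ennreal)"
proof -
  have "(\<Sum>\<^sub>\<infinity>n\<in>I. indicator A (f n)) = (\<Sum>\<^sub>\<infinity>n\<in>{n \<in> I. f n \<in> A}. (1 :: ennreal))"
    by (rule infsum_cong_neutral) auto
  with assms show ?thesis
    by simp
qed

lemma emeasure_sum_measure_dirac: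
  assumes "A \<in> sets borel" and "finite {n \<in> I. f n \<in> A}"
  shows "emeasure (sum_measure I (\<lambda>n. dirac (f n))) A = of_nat (card {n \<in> I. f n \<in> A})"
  using assms by (simp add: emeasure_sum_measure emeasure_dirac infsum_indicator_ennreal)

text \<open>Slicing by tuple index matches the nested sums in \<open>event_measure\<close> and
  reduces finiteness and counting to a single tuple.\<close>

lemma counted_events_eq_Sigma:
  "counted_events E k t D = (SIGMA i:{..<length E}.
     {n \<in> {n. enat n < k}. distance (E ! i) + real n * period (E ! i) \<in> D \<inter> {..t}})"
  by (auto simp: counted_events_def events_def occurrence_def)

lemma finite_counted_indices:
  fixes a p t :: real
  assumes "k = \<infinity> \<Longrightarrow> p > 0"
  shows "finite {n \<in> {n. enat n < k}. a + real n * p \<in> D \<inter> {..t}}"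
proof (cases k)
  case (enat m)
  then show ?thesis
    by simp
next
  case infinity
  with assms have "p > 0"
    by simp
  then have "{n \<in> {n. enat n < k}. a + real n * p \<in> D \<inter> {..t}} \<subseteq> {n. real n \<le> (t - a) / p}"
    by (auto simp: field_simps)
  moreover have "finite {n. real n \<le> (t - a) / p}"
    \<comment> \<open>For a negative quotient the left set is empty, so the truncation of
      \<open>nat\<close> to 0 does no harm.\<close>
    by (rule finite_subset[of _ "{..nat \<lfloor>(t - a) / p\<rfloor>}"]) (auto simp: le_nat_floor)
  ultimately show ?thesis
    by (rule finite_subset)
qed

lemma finite_counted_events:
  assumes "\<And>e. k = \<infinity> \<Longrightarrow> e \<in> set E \<Longrightarrow> period e > 0"
  shows "finite (counted_events E k t D)"
  unfolding counted_events_eq_Sigma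
  using assms by (intro finite_SigmaI finite_counted_indices) auto

lemma sets_event_measure [simp, measurable_cong]: "sets (event_measure E k) = sets borel"
  by (simp add: event_measure_def)

text \<open>The inner sum counts the events of one tuple, and the finite outer sum adds the sizes of
  the slices.\<close>

lemma emeasure_event_measure:
  assumes "\<And>e. k = \<infinity> \<Longrightarrow> e \<in> set E \<Longrightarrow> period e > 0" and "D \<in> sets borel"
  shows "emeasure (event_measure E k) (D \<inter> {..t}) = of_nat (\<eta> E k t D)"
proof -
  let ?N = "\<lambda>i. {n \<in> {n. enat n < k}. distance (E ! i) + real n * period (E ! i) \<in> D \<inter> {..t}}"
  have fin: "finite (?N i)" if "i < length E" for i
    using assms(1) that by (intro finite_counted_indices) auto
  have inner: "emeasure (sum_measure {n. enat n < k}
      (\<lambda>n. dirac (distance (E ! i) + real n * period (E ! i)))) (D \<inter> {..t}) = of_nat (card (?N i))"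
    if "i < length E" for i
    using assms(2) fin[OF that] by (intro emeasure_sum_measure_dirac) auto
  have "emeasure (event_measure E k) (D \<inter> {..t}) = (\<Sum>i<length E. of_nat (card (?N i)))"
    using assms(2) inner by (simp add: event_measure_def emeasure_sum_measure)
  also have "\<dots> = of_nat (\<eta> E k t D)"
    unfolding \<eta>_def counted_events_eq_Sigma using fin by (subst card_SigmaI) auto
  finally show ?thesis .
qed

text \<open>The outer sum has one term and its offset is 0, so the periodic case becomes an instance
  of the general one.\<close>

lemma event_measure_periodic_event_model:
  "event_measure (periodic_event_model p) \<infinity> = sum_measure UNIV (\<lambda>n. dirac (real n * p))"
  by (rule measure_eqI)
     (simp_all add: event_measure_def periodic_event_model_def emeasure_sum_measure lessThan_Suc)

text \<open>\<open>heaviside_upper\<close> includes the left end \<open>t\<^sub>a\<close> and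
  \<open>heaviside_lower\<close> excludes the right end \<open>t\<^sub>b\<close>. In the second
  identity the range of integration supplies the left end; for \<open>t < t\<^sub>a\<close> both
  sides vanish.\<close>

lemma indicator_heaviside:
  fixes t\<^sub>a t\<^sub>b t x :: real
  shows "indicator {..t} x *\<^sub>R (heaviside_upper (x - t\<^sub>a) * heaviside_lower (t\<^sub>b - x)) =
      indicator ({t\<^sub>a..<t\<^sub>b} \<inter> {..t}) x"
    and "indicator {t\<^sub>a..t} x *\<^sub>R heaviside_lower (t\<^sub>b - x) =
      (indicator ({t\<^sub>a..<t\<^sub>b} \<inter> {..t}) x :: real)"
  by (auto simp: heaviside_upper_def heaviside_lower_def indicator_def)

text \<open>Integrability is stated separately because the Bochner integral of a non-integrable
  function is 0 by default, which would make the equations alone ambiguous.\<close>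

lemma event_count_integrals:
  assumes "\<And>e. k = \<infinity> \<Longrightarrow> e \<in> set E \<Longrightarrow> period e > 0"
  shows "set_integrable (event_measure E k) {..t}
      (\<lambda>t'. heaviside_upper (t' - t\<^sub>a) * heaviside_lower (t\<^sub>b - t'))"
    and "set_integrable (event_measure E k) {t\<^sub>a..t} (\<lambda>t'. heaviside_lower (t\<^sub>b - t'))"
    and "real (\<eta> E k t {t\<^sub>a..<t\<^sub>b}) =
      (LINT t':{..t}|event_measure E k. heaviside_upper (t' - t\<^sub>a) * heaviside_lower (t\<^sub>b - t'))"
    and "real (\<eta> E k t {t\<^sub>a..<t\<^sub>b}) =
      (LINT t':{t\<^sub>a..t}|event_measure E k. heaviside_lower (t\<^sub>b - t'))"
proof -
  let ?A = "{t\<^sub>a..<t\<^sub>b} \<inter> {..t}"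
  have A: "emeasure (event_measure E k) ?A = of_nat (\<eta> E k t {t\<^sub>a..<t\<^sub>b})"
    using assms by (rule emeasure_event_measure) auto
  then have int: "integrable (event_measure E k) (indicator ?A :: real \<Rightarrow> real)"
    by (intro integrable_real_indicator) (auto simp: of_nat_less_top)
  \<comment> \<open>The integral of an indicator is the measure of the set intersected with the
    space; this removes the intersection.\<close>
  have "space (event_measure E k) = UNIV"
    using sets_eq_imp_space_eq[OF sets_event_measure] by simp
  with A have lint: "(LINT x|event_measure E k. indicator ?A x) = real (\<eta> E k t {t\<^sub>a..<t\<^sub>b})"
    by (simp add: measure_def)
  show "set_integrable (event_measure E k) {..t}
      (\<lambda>t'. heaviside_upper (t' - t\<^sub>a) * heaviside_lower (t\<^sub>b - t'))"
    and "set_integrable (event_measure E k) {t\<^sub>a..t} (\<lambda>t'. heaviside_lower (t\<^sub>b - t'))"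
    unfolding set_integrable_def indicator_heaviside by (rule int)+
  show "real (\<eta> E k t {t\<^sub>a..<t\<^sub>b}) =
      (LINT t':{..t}|event_measure E k. heaviside_upper (t' - t\<^sub>a) * heaviside_lower (t\<^sub>b - t'))"
    and "real (\<eta> E k t {t\<^sub>a..<t\<^sub>b}) =
      (LINT t':{t\<^sub>a..t}|event_measure E k. heaviside_lower (t\<^sub>b - t'))"
    unfolding set_lebesgue_integral_def indicator_heaviside lint by (rule refl)+
qed

theorem theorem1:
  fixes E :: "event_tuple list" and k :: enat and t\<^sub>a t\<^sub>b t :: real
  assumes "\<And>e. e \<in> set E \<Longrightarrow> period e \<ge> 0"
    and "\<And>e. e \<in> set E \<Longrightarrow> distance e \<ge> 0"
    and "k \<ge> 1"
    and "\<And>e. k = \<infinity> \<Longrightarrow> e \<in> set E \<Longrightarrow> period e > 0"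
  shows
    "(finite (counted_events E k t {t\<^sub>a..<t\<^sub>b}) \<and>
      set_integrable (event_measure E k) {..t}
        (\<lambda>t'. heaviside_upper (t' - t\<^sub>a) * heaviside_lower (t\<^sub>b - t')) \<and>
      set_integrable (event_measure E k) {t\<^sub>a..t} (\<lambda>t'. heaviside_lower (t\<^sub>b - t')) \<and>
      real (\<eta> E k t {t\<^sub>a..<t\<^sub>b}) =
        (LINT t':{..t}|event_measure E k. heaviside_upper (t' - t\<^sub>a) * heaviside_lower (t\<^sub>b - t')) \<and>
      real (\<eta> E k t {t\<^sub>a..<t\<^sub>b}) =
        (LINT t':{t\<^sub>a..t}|event_measure E k. heaviside_lower (t\<^sub>b - t'))) \<and>
     (\<forall>p>0. let P = periodic_event_model p; M = sum_measure UNIV (\<lambda>n. dirac (real n * p)) in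
      finite (counted_events P \<infinity> t {t\<^sub>a..<t\<^sub>b}) \<and>
      set_integrable M {..t}
        (\<lambda>t'. heaviside_upper (t' - t\<^sub>a) * heaviside_lower (t\<^sub>b - t')) \<and>
      set_integrable M {t\<^sub>a..t} (\<lambda>t'. heaviside_lower (t\<^sub>b - t')) \<and>
      real (\<eta> P \<infinity> t {t\<^sub>a..<t\<^sub>b}) =
        (LINT t':{..t}|M. heaviside_upper (t' - t\<^sub>a) * heaviside_lower (t\<^sub>b - t')) \<and>
      real (\<eta> P \<infinity> t {t\<^sub>a..<t\<^sub>b}) =
        (LINT t':{t\<^sub>a..t}|M. heaviside_lower (t\<^sub>b - t')))"
proof (intro conjI allI impI)
  fix p :: real
  assume "p > 0"
  \<comment> \<open>The trivial premise gives the fact the shape of the hypothesis of the general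
    lemmas at \<open>k = \<infinity>\<close>, ready for \<open>OF\<close>.\<close>
  then have "\<And>e. \<infinity> = (\<infinity> :: enat) \<Longrightarrow> e \<in> set (periodic_event_model p) \<Longrightarrow> period e > 0"
    by (simp add: periodic_event_model_def)
  note periodic = finite_counted_events[OF this] event_count_integrals[OF this]
  show "let P = periodic_event_model p; M = sum_measure UNIV (\<lambda>n. dirac (real n * p)) in
      finite (counted_events P \<infinity> t {t\<^sub>a..<t\<^sub>b}) \<and>
      set_integrable M {..t}
        (\<lambda>t'. heaviside_upper (t' - t\<^sub>a) * heaviside_lower (t\<^sub>b - t')) \<and>
      set_integrable M {t\<^sub>a..t} (\<lambda>t'. heaviside_lower (t\<^sub>b - t')) \<and>
      real (\<eta> P \<infinity> t {t\<^sub>a..<t\<^sub>b}) =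
        (LINT t':{..t}|M. heaviside_upper (t' - t\<^sub>a) * heaviside_lower (t\<^sub>b - t')) \<and>
      real (\<eta> P \<infinity> t {t\<^sub>a..<t\<^sub>b}) =
        (LINT t':{t\<^sub>a..t}|M. heaviside_lower (t\<^sub>b - t'))"
    unfolding Let_def event_measure_periodic_event_model[symmetric]
    by (intro conjI periodic)
\<comment> \<open>What remains are the five conjuncts for arbitrary \<open>E\<close> and
  \<open>k\<close>.\<close>
qed (intro finite_counted_events event_count_integrals assms(4); assumption)+

end
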